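(* Let $S\subset\mathbb{R}^2$ be a finite set. Then for every $\varepsilon>0$ there exists $T>0$ such that for every $t>T$ there exists a rotation $\rho\colon\mathbb{R}^2\to\mathbb{R}^2$ around the origin (depending on $\varepsilon$ and $t$) such that $\operatorname{dist}(\rho(tz),\mathbb{Z}^2)<\varepsilon$ for all $z\in S$.
   Context: $\mathbb{Z}^2$ is the standard lattice in the plane $\mathbb{R}^2$, and $\operatorname{dist}(w,\mathbb{Z}^2)$ is the Euclidean distance from $w\in\mathbb{R}^2$ to $\mathbb{Z}^2$. *)

theory Defs
  imports "HOL-Analysis.Analysis"
begin

definition integer_lattice :: "(real ^ 2) set" where
  "integer_lattice = {v. \<forall>i. v $ i \<in> \<int>}"

text \<open>The determinant condition excludes reflections, which are also orthogonal
  transformations of the plane.\<close>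

definition rotation_about_origin :: "(real ^ 2 \<Rightarrow> real ^ 2) \<Rightarrow> bool" where
  "rotation_about_origin \<rho> \<longleftrightarrow> orthogonal_transformation \<rho> \<and> det (matrix \<rho>) = 1"

end

theory Submission
  imports Defs
begin

text \<open>
  The coordinates of a point \<open>t z\<close> rotated by the angle \<open>\<theta>\<close> have the form
  \<open>t (w \<bullet> cis \<theta>)\<close> with \<open>w\<close> in a finite set \<open>W\<close> of complex numbers that depends only on \<open>S\<close>.
  So the task is to make finitely many such phases simultaneously close to integers by the choice
  of \<open>\<theta>\<close>, for every large \<open>t\<close>. This is a Kronecker-type statement along a dilated circle, and it
  has a Fourier-analytic proof.

  The function \<open>\<theta> \<mapsto> (\<Prod>w\<in>W. cos (\<pi> t (w \<bullet> cis \<theta>)) ^ (2 p))\<close> is a combination of the functions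
  \<open>cos (t (v \<bullet> cis \<theta>))\<close> with nonnegative coefficients, where \<open>v\<close> runs over certain integer
  combinations of \<open>W\<close> (times \<open>2 \<pi>\<close>). Terms with \<open>v \<noteq> 0\<close> oscillate and average out to \<open>0\<close> as
  \<open>t\<close> grows; terms with \<open>v = 0\<close> are constant. Rational relations among the elements of \<open>W\<close>
  only produce more terms with \<open>v = 0\<close>, and since these contribute nonnegatively, the limiting
  average is in every case at least the product of the constant Fourier coefficients
  \<open>(2 p choose p) / 4 ^ p \<ge> 1 / (2 p)\<close>, hence at least \<open>(1 / (2 p)) ^ card W\<close>. If, however, at each
  \<open>\<theta>\<close> some phase were at distance at least \<open>\<eta>\<close> from the integers, the product would be bounded
  by \<open>cos (\<pi> \<eta>) ^ (2 p)\<close>. Exponential decay in \<open>p\<close> beats polynomial decay, so a suitable fixed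
  \<open>p\<close> gives a contradiction for all large \<open>t\<close>.

  The averages are taken over an arc on which none of the finitely many nonzero
  phases has a critical point, so that a single integration by parts yields their decay.
\<close>

section \<open>Averages of oscillating phases over an arc\<close>

text \<open>
  Integration by parts: \<open>t cos (t \<psi>)\<close> differs from the derivative of \<open>sin (t \<psi>) / \<psi>'\<close> by a term
  that is bounded uniformly in \<open>t\<close>, so the integral is of order \<open>1 / t\<close>.
\<close>

lemma oscillatory_integral_tendsto_0:
  fixes \<psi> \<psi>' \<psi>'' :: "real \<Rightarrow> real"
  assumes ab: "a \<le> b"
    and d1: "\<And>x. (\<psi> has_real_derivative \<psi>' x) (at x)"
    and d2: "\<And>x. (\<psi>' has_real_derivative \<psi>'' x) (at x)"
    and c2: "continuous_on {a..b} \<psi>''"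
    and nz: "\<And>x. x \<in> {a..b} \<Longrightarrow> \<psi>' x \<noteq> 0"
  shows "((\<lambda>t. integral {a..b} (\<lambda>x. cos (t * \<psi> x))) \<longlongrightarrow> 0) at_top"
proof -
  have c0: "continuous_on {a..b} \<psi>"
    using d1 by (meson DERIV_continuous continuous_at_imp_continuous_on)
  have c1: "continuous_on {a..b} \<psi>'"
    using d2 by (meson DERIV_continuous continuous_at_imp_continuous_on)
  define G where "G x = \<psi>'' x / (\<psi>' x)\<^sup>2" for x
  have cG: "continuous_on {a..b} G"
    unfolding G_def using nz by (intro continuous_intros c1 c2) auto
  obtain K where K: "\<And>x. x \<in> {a..b} \<Longrightarrow> norm (G x) \<le> K"
    using compact_imp_bounded[OF compact_continuous_image[OF cG compact_Icc]]
    unfolding bounded_iff by blast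
  define F where "F t x = sin (t * \<psi> x) / \<psi>' x" for t x
  define C where "C = \<bar>1 / \<psi>' b\<bar> + \<bar>1 / \<psi>' a\<bar> + K * (b - a)"
  have F_bound: "\<bar>F t x\<bar> \<le> \<bar>1 / \<psi>' x\<bar>" for t x
    unfolding F_def abs_divide by (intro divide_right_mono) auto
  have bound: "\<bar>integral {a..b} (\<lambda>x. cos (t * \<psi> x))\<bar> \<le> C / t" if "t > 0" for t
  proof -
    have by_parts: "((\<lambda>x. t * cos (t * \<psi> x) - sin (t * \<psi> x) * G x)
        has_integral F t b - F t a) {a..b}"
    proof (rule fundamental_theorem_of_calculus[OF ab])
      fix x assume x: "x \<in> {a..b}"
      show "(F t has_vector_derivative t * cos (t * \<psi> x) - sin (t * \<psi> x) * G x)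
              (at x within {a..b})"
        unfolding F_def G_def has_real_derivative_iff_has_vector_derivative[symmetric]
        by (rule derivative_eq_intros has_field_derivative_at_within[OF d1]
              has_field_derivative_at_within[OF d2] refl nz x)+
           (use nz[OF x] in \<open>auto simp: field_simps power2_eq_square\<close>)
    qed
    have "(\<lambda>x. sin (t * \<psi> x) * G x) integrable_on {a..b}"
      by (intro integrable_continuous_interval continuous_intros c0 cG)
    from has_integral_add[OF by_parts integrable_integral[OF this]]
    have "((\<lambda>x. t * cos (t * \<psi> x)) has_integral
        F t b - F t a + integral {a..b} (\<lambda>x. sin (t * \<psi> x) * G x)) {a..b}"
      by simp
    then have eq: "t * integral {a..b} (\<lambda>x. cos (t * \<psi> x))
        = F t b - F t a + integral {a..b} (\<lambda>x. sin (t * \<psi> x) * G x)"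
      by (simp only: integral_unique flip: integral_mult_right)
    have "norm (integral {a..b} (\<lambda>x. sin (t * \<psi> x) * G x)) \<le> K * (b - a)"
    proof (rule integral_bound[OF ab])
      show "continuous_on {a..b} (\<lambda>x. sin (t * \<psi> x) * G x)"
        by (intro continuous_intros c0 cG)
      fix x assume "x \<in> {a..b}"
      then show "norm (sin (t * \<psi> x) * G x) \<le> K"
        using mult_mono[OF abs_sin_le_one K, of x "t * \<psi> x"] by (simp add: abs_mult)
    qed
    then have "\<bar>t * integral {a..b} (\<lambda>x. cos (t * \<psi> x))\<bar> \<le> C"
      unfolding eq C_def using F_bound[of t a] F_bound[of t b] by simp
    with that show ?thesis
      by (simp add: abs_mult field_simps)
  qed
  have "((\<lambda>t. C / t) \<longlongrightarrow> 0) at_top"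
    by (intro tendsto_divide_0[OF tendsto_const] filterlim_at_top_imp_at_infinity filterlim_ident)
  moreover have "\<forall>\<^sub>F t in at_top. norm (integral {a..b} (\<lambda>x. cos (t * \<psi> x))) \<le> C / t"
    using eventually_gt_at_top[of 0] by eventually_elim (use bound in simp)
  ultimately show ?thesis
    by (rule Lim_null_comparison[rotated])
qed

text \<open>
  The expression \<open>v \<bullet> (\<i> * cis \<theta>)\<close> is the derivative of the phase \<open>v \<bullet> cis \<theta>\<close>. At
  \<open>\<theta> = arctan s\<close> it vanishes only if \<open>s\<close> solves the linear equation \<open>Re v * s = Im v\<close>. So only
  finitely many slopes have to be avoided, and by continuity an angle at which no phase is critical
  has a neighbourhood of such angles.
\<close>

lemma exists_arc_without_critical_points:
  fixes V :: "complex set"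
  assumes "finite V" "0 \<notin> V"
  shows "\<exists>a b. a < b \<and> (\<forall>v\<in>V. \<forall>\<theta>\<in>{a..b}. v \<bullet> (\<i> * cis \<theta>) \<noteq> 0)"
proof -
  have fin: "finite {s. Re v * s = Im v}" if "v \<noteq> 0" for v
  proof (cases "Re v = 0")
    case True
    then have "{s. Re v * s = Im v} = {}"
      using that by (auto simp: complex_eq_iff)
    then show ?thesis by simp
  next
    case False
    then have "{s. Re v * s = Im v} \<subseteq> {Im v / Re v}"
      by (auto simp: field_simps)
    then show ?thesis
      using finite_subset by blast
  qed
  have "finite (\<Union>v\<in>V. {s. Re v * s = Im v})"
    using assms by (intro finite_UN_I fin) auto
  then obtain s where s: "\<And>v. v \<in> V \<Longrightarrow> Re v * s \<noteq> Im v"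
    using ex_new_if_finite[OF infinite_UNIV_char_0] by blast
  have at_s: "v \<bullet> (\<i> * cis (arctan s)) \<noteq> 0" if "v \<in> V" for v
  proof -
    have "sin (arctan s) = s * cos (arctan s)"
      by (simp add: cos_arctan sin_arctan)
    then have "v \<bullet> (\<i> * cis (arctan s)) = (Im v - Re v * s) * cos (arctan s)"
      by (simp add: inner_complex_def algebra_simps)
    with s[OF that] show ?thesis
      by (simp add: cos_arctan_not_zero)
  qed
  define U where "U = (\<Inter>v\<in>V. {\<theta>. v \<bullet> (\<i> * cis \<theta>) \<noteq> 0})"
  have "open U"
    unfolding U_def using assms(1)
    by (intro open_INT ballI open_Collect_neq continuous_intros) auto
  moreover have "arctan s \<in> U"
    using at_s by (simp add: U_def)
  ultimately obtain e where "e > 0" "cball (arctan s) e \<subseteq> U"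
    using open_contains_cball by blast
  then have "arctan s - e < arctan s + e" "{arctan s - e..arctan s + e} \<subseteq> U"
    by (auto simp: cball_eq_atLeastAtMost)
  then show ?thesis
    unfolding U_def by blast
qed

text \<open>
  Averaged over an arc free of critical points, the sum tends to its constant term as
  \<open>t\<close> grows, and a continuous function somewhere exceeds every number below its average.
\<close>

lemma trigonometric_sum_exceeds:
  fixes v :: "'i \<Rightarrow> complex" and c :: "'i \<Rightarrow> real"
  assumes I: "finite I" and M: "M < (\<Sum>i | i \<in> I \<and> v i = 0. c i)"
  shows "\<forall>\<^sub>F t in at_top. \<exists>\<theta>. M < (\<Sum>i\<in>I. c i * cos (t * (v i \<bullet> cis \<theta>)))"
proof -
  obtain a b where ab: "a < b"
    and arc: "\<And>i \<theta>. i \<in> I \<Longrightarrow> v i \<noteq> 0 \<Longrightarrow> \<theta> \<in> {a..b} \<Longrightarrow> v i \<bullet> (\<i> * cis \<theta>) \<noteq> 0"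
    using exists_arc_without_critical_points[of "v ` I - {0}"] I by auto
  have lim: "((\<lambda>t. integral {a..b} (\<lambda>\<theta>. cos (t * (v i \<bullet> cis \<theta>))))
               \<longlongrightarrow> (if v i = 0 then b - a else 0)) at_top" if "i \<in> I" for i
  proof (cases "v i = 0")
    case False
    have "((\<lambda>t. integral {a..b} (\<lambda>\<theta>. cos (t * (v i \<bullet> cis \<theta>)))) \<longlongrightarrow> 0) at_top"
    proof (rule oscillatory_integral_tendsto_0)
      show "((\<lambda>\<theta>. v i \<bullet> cis \<theta>) has_real_derivative v i \<bullet> (\<i> * cis \<theta>)) (at \<theta>)" for \<theta>
        unfolding inner_complex_def by (auto intro!: derivative_eq_intros)
      show "((\<lambda>\<theta>. v i \<bullet> (\<i> * cis \<theta>)) has_real_derivative - (v i \<bullet> cis \<theta>)) (at \<theta>)" for \<theta>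
        unfolding inner_complex_def by (auto intro!: derivative_eq_intros)
      show "continuous_on {a..b} (\<lambda>\<theta>. - (v i \<bullet> cis \<theta>))"
        by (intro continuous_intros)
    qed (use ab arc[OF that False] in auto)
    with False show ?thesis by simp
  qed (use ab in simp)
  define f where "f t \<theta> = (\<Sum>i\<in>I. c i * cos (t * (v i \<bullet> cis \<theta>)))" for t \<theta>
  have cont: "continuous_on {a..b} (f t)" for t
    unfolding f_def by (intro continuous_intros)
  have "((\<lambda>t. \<Sum>i\<in>I. c i * integral {a..b} (\<lambda>\<theta>. cos (t * (v i \<bullet> cis \<theta>))))
           \<longlongrightarrow> (\<Sum>i\<in>I. c i * (if v i = 0 then b - a else 0))) at_top"
    by (intro tendsto_intros lim)
  moreover have "(\<Sum>i\<in>I. c i * (if v i = 0 then b - a else 0))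
      = (\<Sum>i | i \<in> I \<and> v i = 0. c i) * (b - a)"
    unfolding sum_distrib_right using I by (intro sum.mono_neutral_cong_right) auto
  moreover have "(\<Sum>i\<in>I. c i * integral {a..b} (\<lambda>\<theta>. cos (t * (v i \<bullet> cis \<theta>))))
      = integral {a..b} (f t)" for t
    unfolding f_def using I
    by (subst integral_sum)
       (auto intro!: integrable_continuous_interval continuous_intros)
  ultimately have "((\<lambda>t. integral {a..b} (f t))
      \<longlongrightarrow> (\<Sum>i | i \<in> I \<and> v i = 0. c i) * (b - a)) at_top"
    by simp
  moreover have "M * (b - a) < (\<Sum>i | i \<in> I \<and> v i = 0. c i) * (b - a)"
    using M ab by simp
  ultimately have "\<forall>\<^sub>F t in at_top. M * (b - a) < integral {a..b} (f t)"
    by (rule order_tendstoD)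
  then show ?thesis
  proof eventually_elim
    case (elim t)
    have "\<exists>\<theta>\<in>{a..b}. M < f t \<theta>"
    proof (rule ccontr)
      assume "\<not> (\<exists>\<theta>\<in>{a..b}. M < f t \<theta>)"
      then have "integral {a..b} (f t) \<le> integral {a..b} (\<lambda>_. M)"
        by (intro integral_le integrable_continuous_interval cont) (auto simp: not_less)
      with elim ab show False by (simp add: mult.commute)
    qed
    then show ?case unfolding f_def by blast
  qed
qed

section \<open>Fourier expansion of a product of even cosine powers\<close>

lemma cos_power_expansion:
  fixes x :: real
  shows "complex_of_real (cos x ^ (2 * p))
    = (\<Sum>j\<le>2 * p. of_real (real (2 * p choose j) / 4 ^ p) * cis (2 * (real j - real p) * x))"
proof -
  have "complex_of_real (cos x) = (cis x + cis (- x)) / 2"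
    by (simp add: complex_eq_iff)
  then have "complex_of_real (cos x ^ (2 * p)) = ((cis x + cis (- x)) / 2) ^ (2 * p)"
    by (simp only: of_real_power)
  also have "\<dots> = (cis x + cis (- x)) ^ (2 * p) / 4 ^ p"
    by (simp add: power_divide power_mult)
  also have "\<dots> = (\<Sum>j\<le>2 * p. of_nat (2 * p choose j) * cis x ^ j * cis (- x) ^ (2 * p - j) / 4 ^ p)"
    by (simp add: binomial_ring sum_divide_distrib)
  also have "\<dots> = (\<Sum>j\<le>2 * p. of_real (real (2 * p choose j) / 4 ^ p) * cis (2 * (real j - real p) * x))"
  proof (rule sum.cong)
    fix j assume "j \<in> {..2 * p}"
    then have "cis x ^ j * cis (- x) ^ (2 * p - j) = cis (2 * (real j - real p) * x)"
      by (simp only: Complex.DeMoivre cis_mult) (simp add: of_nat_diff algebra_simps)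
    then show "of_nat (2 * p choose j) * cis x ^ j * cis (- x) ^ (2 * p - j) / 4 ^ p
        = of_real (real (2 * p choose j) / 4 ^ p) * cis (2 * (real j - real p) * x)"
      by (simp add: mult.assoc)
  qed simp
  finally show ?thesis .
qed

lemma prod_cos_power_expansion:
  fixes x :: "'a \<Rightarrow> real"
  assumes "finite W"
  shows "(\<Prod>w\<in>W. cos (x w) ^ (2 * p))
    = (\<Sum>\<kappa>\<in>PiE W (\<lambda>_. {..2 * p}). (\<Prod>w\<in>W. real (2 * p choose \<kappa> w) / 4 ^ p) *
         cos (\<Sum>w\<in>W. 2 * (real (\<kappa> w) - real p) * x w))"
proof -
  have prod_cis: "(\<Prod>w\<in>W. cis (y w)) = cis (\<Sum>w\<in>W. y w)" for y :: "'a \<Rightarrow> real"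
    using assms by (induction rule: finite_induct) (auto simp: cis_mult)
  have "complex_of_real (\<Prod>w\<in>W. cos (x w) ^ (2 * p))
    = (\<Prod>w\<in>W. \<Sum>j\<le>2 * p. of_real (real (2 * p choose j) / 4 ^ p) * cis (2 * (real j - real p) * x w))"
    unfolding of_real_prod cos_power_expansion ..
  also have "\<dots> = (\<Sum>\<kappa>\<in>PiE W (\<lambda>_. {..2 * p}).
      of_real (\<Prod>w\<in>W. real (2 * p choose \<kappa> w) / 4 ^ p) *
        cis (\<Sum>w\<in>W. 2 * (real (\<kappa> w) - real p) * x w))"
    unfolding of_real_prod prod_cis[symmetric] prod.distrib[symmetric]
    using assms by (rule prod_sum_PiE) simp
  finally have "Re (complex_of_real (\<Prod>w\<in>W. cos (x w) ^ (2 * p))) = Re \<dots>"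
    by (rule arg_cong)
  then show ?thesis
    by (simp only: Re_complex_of_real Re_sum scaleR_conv_of_real[symmetric] scaleR_complex.sel cis.sel)
qed

text \<open>
  The bound is the \<open>card W\<close>-th power of a lower bound for the mean \<open>(2 p choose p) / 4 ^ p\<close> of
  \<open>cos ^ (2 p)\<close> over a period. Rational relations among the elements of \<open>W\<close> cannot
  lower the constant term below it, because every relation adds a nonnegative coefficient.
\<close>

lemma prod_cos_power_large:
  fixes W :: "complex set"
  assumes W: "finite W" and p: "p > 0" and M: "M < (1 / (2 * real p)) ^ card W"
  shows "\<forall>\<^sub>F t in at_top. \<exists>\<theta>. M < (\<Prod>w\<in>W. cos (pi * (t * (w \<bullet> cis \<theta>))) ^ (2 * p))"
proof -
  define I where "I = PiE W (\<lambda>_. {..2 * p})"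
  define c where "c \<kappa> = (\<Prod>w\<in>W. real (2 * p choose \<kappa> w) / 4 ^ p)" for \<kappa> :: "complex \<Rightarrow> nat"
  define v where "v \<kappa> = (\<Sum>w\<in>W. (2 * (real (\<kappa> w) - real p) * pi) *\<^sub>R w)" for \<kappa> :: "complex \<Rightarrow> nat"
  \<comment> \<open>The index selecting the constant term of every factor; its frequency is zero whatever \<open>W\<close> is.\<close>
  define \<kappa>\<^sub>0 where "\<kappa>\<^sub>0 = restrict (\<lambda>_. p) W"
  have I: "finite I"
    unfolding I_def using W by (intro finite_PiE) auto
  have "1 / (2 * real p) \<le> real (2 * p choose p) / 4 ^ p"
    using central_binomial_lower_bound[OF p] p by (simp add: field_simps)
  then have "(1 / (2 * real p)) ^ card W \<le> c \<kappa>\<^sub>0"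
    unfolding c_def \<kappa>\<^sub>0_def by (simp add: power_mono)
  also have "\<dots> \<le> (\<Sum>\<kappa> | \<kappa> \<in> I \<and> v \<kappa> = 0. c \<kappa>)"
    using I by (intro member_le_sum)
      (auto simp: I_def v_def \<kappa>\<^sub>0_def c_def intro!: prod_nonneg)
  finally have "M < (\<Sum>\<kappa> | \<kappa> \<in> I \<and> v \<kappa> = 0. c \<kappa>)"
    using M by linarith
  moreover have "(\<Prod>w\<in>W. cos (pi * (t * (w \<bullet> cis \<theta>))) ^ (2 * p))
      = (\<Sum>\<kappa>\<in>I. c \<kappa> * cos (t * (v \<kappa> \<bullet> cis \<theta>)))" for t \<theta>
  proof -
    have "t * (v \<kappa> \<bullet> cis \<theta>)
        = (\<Sum>w\<in>W. 2 * (real (\<kappa> w) - real p) * (pi * (t * (w \<bullet> cis \<theta>))))" for \<kappa>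
      by (simp add: v_def inner_sum_left sum_distrib_left mult_ac)
    then show ?thesis
      by (simp only: prod_cos_power_expansion[OF W] I_def c_def)
  qed
  ultimately show ?thesis
    using trigonometric_sum_exceeds[OF I] by simp
qed

section \<open>Simultaneous approximation by integers\<close>

lemma near_integer_if_cos_large:
  fixes x \<eta> :: real
  assumes "0 < \<eta>" "\<eta> \<le> 1/2" and cos: "\<bar>cos (pi * \<eta>)\<bar> < \<bar>cos (pi * x)\<bar>"
  shows "\<bar>x - of_int (round x)\<bar> < \<eta>"
proof (rule ccontr)
  define y where "y = \<bar>x - of_int (round x)\<bar>"
  assume "\<not> \<bar>x - of_int (round x)\<bar> < \<eta>"
  then have y: "\<eta> \<le> y" "y \<le> 1/2"
    using of_int_round_abs_le[of x] by (auto simp: y_def abs_minus_commute)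
  have "0 \<le> pi * y"
    using y assms(1) by simp
  moreover have "pi * y \<le> pi / 2"
    using mult_left_mono[OF y(2) pi_ge_zero] by simp
  ultimately have angle: "- (pi / 2) \<le> pi * y" "pi * y \<le> pi / 2"
    using pi_ge_zero by linarith+
  have "pi * x = pi * (x - of_int (round x)) + pi * of_int (round x)"
    by (simp add: algebra_simps)
  then have "\<bar>cos (pi * x)\<bar> = \<bar>cos (pi * (x - of_int (round x)))\<bar>"
    by (simp add: cos_add cos_int_times_real sin_int_times_real abs_mult)
  also have "\<dots> = \<bar>cos (pi * y)\<bar>"
    using cos_abs_real[of "pi * (x - of_int (round x))"] by (simp add: y_def abs_mult)
  also have "\<dots> = cos (pi * y)"
    using angle by (intro abs_of_nonneg cos_ge_zero) auto
  also have "\<dots> \<le> cos (pi * \<eta>)"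
    using y assms by (intro cos_monotone_0_pi_le) (auto simp: field_simps)
  finally show False
    using cos by linarith
qed

text \<open>
  All factors of the product in the preceding section lie in \<open>{0..1}\<close>, so a product above
  \<open>cos (\<pi> \<eta>) ^ (2 p)\<close> forces each factor above that value, which places its phase within \<open>\<eta>\<close> of an
  integer. Such a product is available once \<open>p\<close> is so large that \<open>cos (\<pi> \<eta>) ^ (2 p)\<close> has dropped
  below \<open>(1 / (2 p)) ^ card W\<close>.
\<close>

lemma simultaneously_near_integers:
  fixes W :: "complex set"
  assumes W: "finite W" and \<eta>: "0 < \<eta>" "\<eta> \<le> 1/2"
  shows "\<forall>\<^sub>F t in at_top. \<exists>\<theta>. \<forall>w\<in>W.
           \<bar>t * (w \<bullet> cis \<theta>) - of_int (round (t * (w \<bullet> cis \<theta>)))\<bar> < \<eta>"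
proof (cases "W = {}")
  case False
  define m where "m = card W"
  have m: "m > 0"
    using False W by (simp add: m_def card_gt_0_iff)
  define q where "q = (cos (pi * \<eta>))\<^sup>2"
  have angle: "0 < pi * \<eta>" "pi * \<eta> \<le> pi / 2"
    using \<eta> by (auto simp: field_simps)
  then have "0 \<le> cos (pi * \<eta>)" "cos (pi * \<eta>) < 1"
    using cos_ge_zero[of "pi * \<eta>"] cos_monotone_0_pi[of 0 "pi * \<eta>"] by auto
  then have q: "0 \<le> q" "q < 1"
    unfolding q_def by (auto simp: power_less_one_iff abs_square_less_1)
  \<comment> \<open>Taking \<open>m\<close>-th roots turns the required \<open>q ^ p < (1 / (2 p)) ^ m\<close> into a comparison with a linear factor.\<close>
  have "(\<lambda>p. real p * root m q ^ p) \<longlonglongrightarrow> 0"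
    using q m by (intro powser_times_n_limit_0) (simp add: real_root_lt_1_iff)
  then have "\<forall>\<^sub>F p in sequentially. real p * root m q ^ p < 1 / 2"
    by (rule order_tendstoD) simp
  from eventually_happens'[OF sequentially_bot eventually_conj[OF eventually_gt_at_top[of 0] this]]
  obtain p where p: "p > 0" "real p * root m q ^ p < 1 / 2"
    by blast
  then have "root m q ^ p < 1 / (2 * real p)"
    by (simp add: field_simps)
  then have "(root m q ^ p) ^ m < (1 / (2 * real p)) ^ m"
    using q m by (intro power_strict_mono) auto
  moreover have "(root m q ^ p) ^ m = (root m q ^ m) ^ p"
    by (simp only: mult.commute flip: power_mult)
  ultimately have "q ^ p < (1 / (2 * real p)) ^ card W"
    using q m by (simp add: m_def)
  from prod_cos_power_large[OF W p(1) this] show ?thesis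
  proof eventually_elim
    case (elim t)
    then obtain \<theta> where \<theta>: "q ^ p < (\<Prod>w\<in>W. cos (pi * (t * (w \<bullet> cis \<theta>))) ^ (2 * p))"
      by blast
    have "\<bar>t * (w \<bullet> cis \<theta>) - of_int (round (t * (w \<bullet> cis \<theta>)))\<bar> < \<eta>" if "w \<in> W" for w
    proof (rule near_integer_if_cos_large[OF \<eta>])
      have "(\<Prod>w\<in>W. cos (pi * (t * (w \<bullet> cis \<theta>))) ^ (2 * p))
          = cos (pi * (t * (w \<bullet> cis \<theta>))) ^ (2 * p) *
            (\<Prod>w\<in>W - {w}. cos (pi * (t * (w \<bullet> cis \<theta>))) ^ (2 * p))"
        using W that by (rule prod.remove)
      also have "\<dots> \<le> cos (pi * (t * (w \<bullet> cis \<theta>))) ^ (2 * p) * 1"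
        by (intro mult_left_mono prod_le_1)
          (auto simp: power_mult power_le_one abs_square_le_1)
      finally have "q ^ p < ((cos (pi * (t * (w \<bullet> cis \<theta>))))\<^sup>2) ^ p"
        using \<theta> by (simp add: power_mult)
      then have "q < (cos (pi * (t * (w \<bullet> cis \<theta>))))\<^sup>2"
        by (rule power_less_imp_less_base) simp
      then show "\<bar>cos (pi * \<eta>)\<bar> < \<bar>cos (pi * (t * (w \<bullet> cis \<theta>)))\<bar>"
        by (simp add: q_def abs_le_square_iff flip: not_le)
    qed
    then show ?case by blast
  qed
qed simp

section \<open>Rotations and the integer lattice\<close>

definition plane_rotation :: "real \<Rightarrow> real ^ 2 \<Rightarrow> real ^ 2" where
  "plane_rotation \<theta> x =
     vector [cos \<theta> * x $ 1 - sin \<theta> * x $ 2, sin \<theta> * x $ 1 + cos \<theta> * x $ 2]"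

lemma rotation_about_origin_plane_rotation:
  "rotation_about_origin (plane_rotation \<theta>)"
proof -
  have "linear (plane_rotation \<theta>)"
    by (rule linearI) (auto simp: plane_rotation_def vec_eq_iff forall_2 algebra_simps)
  moreover have "plane_rotation \<theta> x \<bullet> plane_rotation \<theta> y = x \<bullet> y" for x y
  proof -
    have "plane_rotation \<theta> x \<bullet> plane_rotation \<theta> y
        = ((cos \<theta>)\<^sup>2 + (sin \<theta>)\<^sup>2) * (x $ 1 * y $ 1 + x $ 2 * y $ 2)"
      unfolding power2_eq_square
      by (simp add: plane_rotation_def inner_vec_def sum_2 algebra_simps del: sin_cos_squared_add3)
    then show ?thesis
      by (simp add: inner_vec_def sum_2)
  qed
  moreover have "det (matrix (plane_rotation \<theta>)) = 1"
    by (simp add: det_2 matrix_def plane_rotation_def axis_def flip: power2_eq_square)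
  ultimately show ?thesis
    by (simp add: rotation_about_origin_def orthogonal_transformation_def)
qed

lemma infdist_integer_lattice_le:
  "infdist y integer_lattice \<le> \<bar>y $ 1 - of_int (round (y $ 1))\<bar> + \<bar>y $ 2 - of_int (round (y $ 2))\<bar>"
proof -
  define n :: "real ^ 2" where "n = (\<chi> i. of_int (round (y $ i)))"
  have "n \<in> integer_lattice"
    by (simp add: n_def integer_lattice_def)
  then have "infdist y integer_lattice \<le> norm (y - n)"
    unfolding dist_norm[symmetric] by (rule infdist_le)
  also have "\<dots> \<le> (\<Sum>i\<in>UNIV. \<bar>(y - n) $ i\<bar>)"
    by (rule norm_le_l1_cart)
  finally show ?thesis
    by (simp add: sum_2 n_def)
qed

theorem theorem3p1:
  fixes S :: "(real ^ 2) set"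
  assumes "finite S"
  shows "\<forall>\<epsilon>>0. \<exists>T>0. \<forall>t>T. \<exists>\<rho>. rotation_about_origin \<rho> \<and>
           (\<forall>z\<in>S. infdist (\<rho> (t *\<^sub>R z)) integer_lattice < \<epsilon>)"
proof (intro allI impI)
  fix \<epsilon> :: real
  assume "\<epsilon> > 0"
  define \<eta> where "\<eta> = min (\<epsilon> / 2) (1 / 2)"
  have \<eta>: "0 < \<eta>" "\<eta> \<le> 1/2" "2 * \<eta> \<le> \<epsilon>"
    using \<open>\<epsilon> > 0\<close> by (auto simp: \<eta>_def)
  define w\<^sub>1 w\<^sub>2 where "w\<^sub>1 z = Complex (z $ 1) (- (z $ 2))" and "w\<^sub>2 z = Complex (z $ 2) (z $ 1)"
    for z :: "real ^ 2"
  \<comment> \<open>These encode the two rows of the rotation matrix applied to \<open>z\<close> as inner products with \<open>cis \<theta>\<close>.\<close>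
  have coord: "plane_rotation \<theta> (t *\<^sub>R z) $ 1 = t * (w\<^sub>1 z \<bullet> cis \<theta>)"
      "plane_rotation \<theta> (t *\<^sub>R z) $ 2 = t * (w\<^sub>2 z \<bullet> cis \<theta>)" for \<theta> t z
    by (simp_all add: plane_rotation_def w\<^sub>1_def w\<^sub>2_def inner_complex_def algebra_simps)
  have "finite (w\<^sub>1 ` S \<union> w\<^sub>2 ` S)"
    using assms by simp
  from simultaneously_near_integers[OF this \<eta>(1,2)]
  have "\<forall>\<^sub>F t in at_top. \<exists>\<theta>. \<forall>z\<in>S. infdist (plane_rotation \<theta> (t *\<^sub>R z)) integer_lattice < \<epsilon>"
  proof eventually_elim
    case (elim t)
    then obtain \<theta> where near: "\<forall>w\<in>w\<^sub>1 ` S \<union> w\<^sub>2 ` S.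
        \<bar>t * (w \<bullet> cis \<theta>) - of_int (round (t * (w \<bullet> cis \<theta>)))\<bar> < \<eta>"
      by blast
    have "infdist (plane_rotation \<theta> (t *\<^sub>R z)) integer_lattice < \<epsilon>" if "z \<in> S" for z
    proof -
      have "\<bar>t * (w \<bullet> cis \<theta>) - of_int (round (t * (w \<bullet> cis \<theta>)))\<bar> < \<eta>" if "w \<in> {w\<^sub>1 z, w\<^sub>2 z}" for w
        using near that \<open>z \<in> S\<close> by blast
      from this[of "w\<^sub>1 z"] this[of "w\<^sub>2 z"] show ?thesis
        using infdist_integer_lattice_le[of "plane_rotation \<theta> (t *\<^sub>R z)"] \<eta>(3)
        unfolding coord by simp
    qed
    then show ?case by blast
  qed
  then obtain T where T: "\<And>t. t \<ge> T \<Longrightarrow>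
      \<exists>\<theta>. \<forall>z\<in>S. infdist (plane_rotation \<theta> (t *\<^sub>R z)) integer_lattice < \<epsilon>"
    unfolding eventually_at_top_linorder by blast
  show "\<exists>T>0. \<forall>t>T. \<exists>\<rho>. rotation_about_origin \<rho> \<and>
          (\<forall>z\<in>S. infdist (\<rho> (t *\<^sub>R z)) integer_lattice < \<epsilon>)"
  proof (intro exI[of _ "max T 1"] conjI allI impI)
    fix t assume "t > max T 1"
    then obtain \<theta> where "\<forall>z\<in>S. infdist (plane_rotation \<theta> (t *\<^sub>R z)) integer_lattice < \<epsilon>"
      using T[of t] by auto
    with rotation_about_origin_plane_rotation
    show "\<exists>\<rho>. rotation_about_origin \<rho> \<and> (\<forall>z\<in>S. infdist (\<rho> (t *\<^sub>R z)) integer_lattice < \<epsilon>)"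
      by blast
  qed simp
qed

end
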